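(* Let $Y$ be a locally compact space with a Radon measure $\mu$, and let $\langle\mathfrak V,\mathfrak Q;X,Y\rangle$ be an invariant $(\Theta,\mathcal E,\mu)$-structure with $\mathfrak V=\langle\langle\mathfrak E,\tau\rangle,\pi,X,\{\nu_j:j\in J\}\rangle$, $\mathfrak Q=\langle\langle\mathfrak H,\gamma\rangle,\xi,X,\mathfrak Y\rangle$, where $\Theta=\{B_w:w\in\mathcal E\}$ with $B_w(x)=\{w(x)\}$. Then for all $x\in X$ $$\Bigl\{H\in\Bigl[\Bigl(\prod^b_{z\in X}\mathfrak H_z\Bigr)^x_\diamond\Bigr]_{peq}:\ H_t\bullet\mathcal E(\Theta)\subseteq\Gamma^x(\pi)\ \ \forall t\in Y\Bigr\}\subseteq\Gamma_\diamond^x(\xi).$$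
   Context: Vector spaces are over $\mathbb C$; Hlcs means Hausdorff locally convex space. Bundles. A bundle of $\Omega$-spaces $\langle\langle\mathfrak E,\tau\rangle,\pi,X,\mathfrak N\rangle$ (Gierz) consists of topological spaces $\langle\mathfrak E,\tau\rangle$ and $X$, a continuous open surjection $\pi:\mathfrak E\to X$, a vector space structure on each stalk $\mathfrak E_x=\pi^{-1}(x)$ such that addition $\{(a,b):\pi(a)=\pi(b)\}\to\mathfrak E$ and scalar multiplication are continuous, and a set $\mathfrak N=\{\nu_j:j\in J\}$ of functions $\mathfrak E\to[0,\infty[$ whose restrictions to each $\mathfrak E_x$ form a directed family of seminorms generating the (Hausdorff) topology induced by $\tau$ on $\mathfrak E_x$. For $U\subseteq X$, $\prod^b_{x\in U}\mathfrak E_x$ is the set of $\sigma\in\prod_{x\in U}\mathfrak E_x$ with $\sup_{x\in U}\nu_j(\sigma(x))<\infty$ for all $j$; $\Gamma_U(\pi)$ (resp. $\Gamma_U^x(\pi)$) is the set of those continuous (resp. continuous at $x\in U$); $U$ is omitted if $U=X$. The tubes $\{\beta:\pi(\beta)\in U,\nu_j(\beta-\sigma(\pi(\beta)))<\varepsilon\}$ ($U$ open, $\sigma\in\Gamma_U(\pi)$, $\varepsilon>0$, $j\in J$) form a base of $\tau$. For a set $A$ of sections of $\mathfrak Q$, $A_\diamond^x=\{H\in A:\exists F\in\Gamma(\xi),\ H(x)=F(x)\}$, and $\Gamma_\diamond^x(\xi)=(\Gamma^x(\xi))^x_\diamond$. $\mathfrak L_1(Y,E,\mu)$ ($E$ a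 Hlcs): scalarly essentially $\mu$-integrable maps $Y\to E$ whose (weak) integral belongs to $E$ (Bourbaki). $(\Theta,\mathcal E,\mu)$-structure. Let $\mathcal E\subseteq\Gamma(\pi)$, $\Theta\subseteq\prod_xBounded(\mathfrak E_x)$, $\mathsf D(B,\mathcal E)=\mathcal E\cap\prod_xB(x)$, $\mathcal B_B^x=\{v(x):v\in\mathsf D(B,\mathcal E)\}$, $S_x=\{\mathcal B_B^x:B\in\Theta\}$, $\mathcal E(\Theta)=\bigcup_B\mathsf D(B,\mathcal E)$; $\mathcal L_{S_x}(\mathfrak E_x)$: continuous linear endomorphisms with uniform convergence on members of $S_x$. $\langle\mathfrak V,\mathfrak Q;X,Y\rangle$ is a $(\Theta,\mathcal E,\mu)$-structure if all $\mathsf D(B,\mathcal E)\ne\emptyset$, $\bigcup_B\mathcal B_B^x$ is total in $\mathfrak E_x$ for all $x$, and $\mathfrak Q$ is a bundle of $\Omega$-spaces with $\mathfrak H_x\subseteq\mathfrak L_1(Y,\mathcal L_{S_x}(\mathfrak E_x),\mu)$ and directed family of seminorms $\sup_{(t,j,B)\in O}P^x_{(t,j,B)}$, $O$ finite $\subset Y\times J\times\Theta$, $P^x_{(t,j,B)}(F)=\sup_{v\in\mathsf D(B,\mathcal E)}\nu_j(F(t)v(x))$. For $F\in\prod_x\mathcal L(\mathfrak E_x)^Y$, $t\in Y$: $F_t(x)=F(x)(t)$; $(Q\bullet w)(x)=Q(x)(w(x))$. The structure is invariant if $\{F\in\prod_z^b\mathfrak H_z:F_t\bullet\mathcal E(\Theta)\subseteq\Gamma(\pi)\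 \forall t\in Y\}=\Gamma(\xi)$. (For $\Theta=\{B_w:w\in\mathcal E\}$ one has $\mathsf D(B_w,\mathcal E)=\{w\}$ and $\mathcal E(\Theta)=\mathcal E$.) For a set $A\subseteq\prod_x\mathfrak H_x$, $A_{peq}$ is the set of pointwise equicontinuous $F\in A$: for every $t\in Y$ and $j\in J$ there are $a>0$, $j_1\in J$ with $\nu_j(F(z)(t)v_z)\le a\,\nu_{j_1}(v_z)$ for all $z\in X$, $v_z\in\mathfrak E_z$. *)

theory Defs
  imports
    "HOL-Analysis.Analysis"
    "HOL-Algebra.Module"
    "HOL-Algebra.Algebraic_Closure_Type"
begin

abbreviation complex_field :: "complex ring"
  where "complex_field \<equiv> ring_of_type_algebra"

definition linear_maps ::
    "(complex, 'a) module \<Rightarrow> (complex, 'b) module \<Rightarrow> ('a \<Rightarrow> 'b) set"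
  where "linear_maps M N =
    {T \<in> carrier M \<rightarrow>\<^sub>E carrier N.
       (\<forall>a\<in>carrier M. \<forall>b\<in>carrier M. T (a \<oplus>\<^bsub>M\<^esub> b) = T a \<oplus>\<^bsub>N\<^esub> T b) \<and>
       (\<forall>c. \<forall>a\<in>carrier M. T (c \<odot>\<^bsub>M\<^esub> a) = c \<odot>\<^bsub>N\<^esub> T a)}"

definition seminorm_on :: "(complex, 'a) module \<Rightarrow> ('a \<Rightarrow> real) \<Rightarrow> bool"
  where "seminorm_on M p \<longleftrightarrow>
    (\<forall>a\<in>carrier M. 0 \<le> p a) \<and>
    (\<forall>a\<in>carrier M. \<forall>b\<in>carrier M. p (a \<oplus>\<^bsub>M\<^esub> b) \<le> p a + p b) \<and>
    (\<forall>c. \<forall>a\<in>carrier M. p (c \<odot>\<^bsub>M\<^esub> a) = cmod c * p a)"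

definition seminorm_topology :: "(complex, 'a) module \<Rightarrow> ('a \<Rightarrow> real) set \<Rightarrow> 'a topology"
  where "seminorm_topology M P = topology_generated_by
    (insert (carrier M)
      {{b \<in> carrier M. p (b \<ominus>\<^bsub>M\<^esub> a) < \<epsilon>} | p a \<epsilon>. p \<in> P \<and> a \<in> carrier M \<and> \<epsilon> > 0})"

definition linear_span :: "(complex, 'a) module \<Rightarrow> 'a set \<Rightarrow> 'a set"
  where "linear_span M A = (\<lambda>W. submodule W complex_field M) hull A"

definition scalar_module :: "(complex, complex) module"
  where "scalar_module =
    \<lparr>carrier = UNIV, mult = (*), one = 1, zero = 0, add = (+), smult = (*)\<rparr>"

definition continuous_dual ::
    "(complex, 'a) module \<Rightarrow> ('a \<Rightarrow> real) set \<Rightarrow> ('a \<Rightarrow> complex) set"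
  where "continuous_dual M P =
    {l \<in> linear_maps M scalar_module. continuous_map (seminorm_topology M P) euclidean l}"

text \<open>
  Following Bourbaki, a Radon measure on a locally compact space is a (complex) linear form on the
  space of continuous functions with compact support, continuous for the inductive limit topology.
  Functions with compact support are taken to vanish outside the carrier of the space.
\<close>

definition Cc :: "'y topology \<Rightarrow> ('y \<Rightarrow> complex) set"
  where "Cc Y = {f. continuous_map Y euclidean f \<and>
    (\<exists>K. compactin Y K \<and> (\<forall>y. y \<notin> K \<longrightarrow> f y = 0))}"

definition radon_measure :: "'y topology \<Rightarrow> (('y \<Rightarrow> complex) \<Rightarrow> complex) \<Rightarrow> bool"
  where "radon_measure Y \<mu> \<longleftrightarrow>
    (\<forall>f\<in>Cc Y. \<forall>g\<in>Cc Y. \<mu> (\<lambda>y. f y + g y) = \<mu> f + \<mu> g) \<and>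
    (\<forall>c. \<forall>f\<in>Cc Y. \<mu> (\<lambda>y. c * f y) = c * \<mu> f) \<and>
    (\<forall>K. compactin Y K \<longrightarrow>
      (\<exists>M. \<forall>f\<in>Cc Y. \<forall>b. (\<forall>y. y \<notin> K \<longrightarrow> f y = 0) \<and> (\<forall>y. cmod (f y) \<le> b)
              \<longrightarrow> cmod (\<mu> f) \<le> M * b))"

text \<open>
  The absolute value \<open>|\<mu>|\<close> on nonnegative functions with compact support, its upper integral
  (first on lower semicontinuous functions, then on arbitrary ones), and the essential upper
  integral, which is the supremum of the upper integrals over compact sets.
\<close>

definition radon_abs :: "'y topology \<Rightarrow> (('y \<Rightarrow> complex) \<Rightarrow> complex) \<Rightarrow> ('y \<Rightarrow> real) \<Rightarrow> ennreal"
  where "radon_abs Y \<mu> \<phi> = (SUP g\<in>{g \<in> Cc Y. \<forall>y. cmod (g y) \<le> \<phi> y}. ennreal (cmod (\<mu> g)))"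

definition upper_integral_lsc ::
    "'y topology \<Rightarrow> (('y \<Rightarrow> complex) \<Rightarrow> complex) \<Rightarrow> ('y \<Rightarrow> ennreal) \<Rightarrow> ennreal"
  where "upper_integral_lsc Y \<mu> h =
    (SUP \<phi>\<in>{\<phi>. (\<lambda>y. complex_of_real (\<phi> y)) \<in> Cc Y \<and> (\<forall>y. 0 \<le> \<phi> y) \<and>
               (\<forall>y\<in>topspace Y. ennreal (\<phi> y) \<le> h y)}. radon_abs Y \<mu> \<phi>)"

definition upper_integral ::
    "'y topology \<Rightarrow> (('y \<Rightarrow> complex) \<Rightarrow> complex) \<Rightarrow> ('y \<Rightarrow> ennreal) \<Rightarrow> ennreal"
  where "upper_integral Y \<mu> f =
    (INF h\<in>{h. (\<forall>a. openin Y {y \<in> topspace Y. a < h y}) \<and> (\<forall>y\<in>topspace Y. f y \<le> h y)}.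
       upper_integral_lsc Y \<mu> h)"

definition ess_upper_integral ::
    "'y topology \<Rightarrow> (('y \<Rightarrow> complex) \<Rightarrow> complex) \<Rightarrow> ('y \<Rightarrow> ennreal) \<Rightarrow> ennreal"
  where "ess_upper_integral Y \<mu> f =
    (SUP K\<in>{K. compactin Y K}. upper_integral Y \<mu> (\<lambda>y. f y * indicator K y))"

text \<open>
  The essentially integrable functions are the closure of \<^term>\<open>Cc Y\<close> for the seminorm given by
  the essential upper integral of the modulus; the integral is the continuous extension of \<open>\<mu>\<close>.
\<close>

definition has_ess_integral ::
    "'y topology \<Rightarrow> (('y \<Rightarrow> complex) \<Rightarrow> complex) \<Rightarrow> ('y \<Rightarrow> complex) \<Rightarrow> complex \<Rightarrow> bool"
  where "has_ess_integral Y \<mu> f I \<longleftrightarrow>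
    (\<forall>\<epsilon>>0. \<exists>\<phi>\<in>Cc Y. ess_upper_integral Y \<mu> (\<lambda>y. ennreal (cmod (f y - \<phi> y))) \<le> ennreal \<epsilon> \<and>
                     cmod (I - \<mu> \<phi>) \<le> \<epsilon>)"

text \<open>
  \<open>L1_space Y \<mu> M P\<close> is the set of scalarly essentially \<open>\<mu>\<close>-integrable maps from \<open>Y\<close> to the
  locally convex space \<open>M\<close> (topologized by the seminorms \<open>P\<close>) whose weak integral lies in \<open>M\<close>.
\<close>

definition L1_space ::
    "'y topology \<Rightarrow> (('y \<Rightarrow> complex) \<Rightarrow> complex) \<Rightarrow> (complex, 'a) module \<Rightarrow> ('a \<Rightarrow> real) set
      \<Rightarrow> ('y \<Rightarrow> 'a) set"
  where "L1_space Y \<mu> M P =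
    {f \<in> topspace Y \<rightarrow>\<^sub>E carrier M.
       (\<forall>l\<in>continuous_dual M P. \<exists>I. has_ess_integral Y \<mu> (\<lambda>t. l (f t)) I) \<and>
       (\<exists>e\<in>carrier M. \<forall>l\<in>continuous_dual M P. has_ess_integral Y \<mu> (\<lambda>t. l (f t)) (l e))}"

record ('x, 'e, 'j) tvs_bundle =
  total :: "'e topology"
  proj :: "'e \<Rightarrow> 'x"
  base_space :: "'x topology"
  stalk :: "'x \<Rightarrow> (complex, 'e) module"
  sn_index :: "'j set"
  sn :: "'j \<Rightarrow> 'e \<Rightarrow> real"

definition bounded_sections :: "('x, 'e, 'j) tvs_bundle \<Rightarrow> 'x set \<Rightarrow> ('x \<Rightarrow> 'e) set"
  where "bounded_sections V U =
    {\<sigma> \<in> (\<Pi>\<^sub>E x\<in>U. carrier (stalk V x)). \<forall>j\<in>sn_index V. bdd_above ((\<lambda>x. sn V j (\<sigma> x)) ` U)}"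

definition cont_sections_on :: "('x, 'e, 'j) tvs_bundle \<Rightarrow> 'x set \<Rightarrow> ('x \<Rightarrow> 'e) set"
  where "cont_sections_on V U =
    {\<sigma> \<in> bounded_sections V U. continuous_map (subtopology (base_space V) U) (total V) \<sigma>}"

definition cont_sections_on_at :: "('x, 'e, 'j) tvs_bundle \<Rightarrow> 'x set \<Rightarrow> 'x \<Rightarrow> ('x \<Rightarrow> 'e) set"
  where "cont_sections_on_at V U x =
    {\<sigma> \<in> bounded_sections V U. topcontinuous_at (subtopology (base_space V) U) (total V) \<sigma> x}"

abbreviation cont_sections :: "('x, 'e, 'j) tvs_bundle \<Rightarrow> ('x \<Rightarrow> 'e) set"
  where "cont_sections V \<equiv> cont_sections_on V (topspace (base_space V))"

abbreviation cont_sections_at :: "('x, 'e, 'j) tvs_bundle \<Rightarrow> 'x \<Rightarrow> ('x \<Rightarrow> 'e) set"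
  where "cont_sections_at V x \<equiv> cont_sections_on_at V (topspace (base_space V)) x"

definition tube :: "('x, 'e, 'j) tvs_bundle \<Rightarrow> 'x set \<Rightarrow> ('x \<Rightarrow> 'e) \<Rightarrow> real \<Rightarrow> 'j \<Rightarrow> 'e set"
  where "tube V U \<sigma> \<epsilon> j =
    {\<beta> \<in> topspace (total V). proj V \<beta> \<in> U \<and>
        sn V j (\<beta> \<ominus>\<^bsub>stalk V (proj V \<beta>)\<^esub> \<sigma> (proj V \<beta>)) < \<epsilon>}"

definition tubes :: "('x, 'e, 'j) tvs_bundle \<Rightarrow> 'e set set"
  where "tubes V = {tube V U \<sigma> \<epsilon> j | U \<sigma> \<epsilon> j.
    openin (base_space V) U \<and> \<sigma> \<in> cont_sections_on V U \<and> \<epsilon> > 0 \<and> j \<in> sn_index V}"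

definition stalk_topology :: "('x, 'e, 'j) tvs_bundle \<Rightarrow> 'x \<Rightarrow> 'e topology"
  where "stalk_topology V x = subtopology (total V) (carrier (stalk V x))"

definition omega_bundle :: "('x, 'e, 'j) tvs_bundle \<Rightarrow> bool"
  where "omega_bundle V \<longleftrightarrow>
    continuous_map (total V) (base_space V) (proj V) \<and>
    open_map (total V) (base_space V) (proj V) \<and>
    proj V ` topspace (total V) = topspace (base_space V) \<and>
    (\<forall>x\<in>topspace (base_space V).
       module complex_field (stalk V x) \<and>
       carrier (stalk V x) = {e \<in> topspace (total V). proj V e = x}) \<and>
    continuous_map
      (subtopology (prod_topology (total V) (total V)) {(a, b). proj V a = proj V b})
      (total V) (\<lambda>(a, b). a \<oplus>\<^bsub>stalk V (proj V a)\<^esub> b) \<and>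
    continuous_map (prod_topology euclidean (total V)) (total V)
      (\<lambda>(c, a). c \<odot>\<^bsub>stalk V (proj V a)\<^esub> a) \<and>
    (\<forall>x\<in>topspace (base_space V).
       (\<forall>j\<in>sn_index V. seminorm_on (stalk V x) (sn V j)) \<and>
       (\<forall>i\<in>sn_index V. \<forall>j\<in>sn_index V. \<exists>k\<in>sn_index V. \<forall>e\<in>carrier (stalk V x).
          sn V i e \<le> sn V k e \<and> sn V j e \<le> sn V k e) \<and>
       stalk_topology V x = seminorm_topology (stalk V x) (sn V ` sn_index V) \<and>
       Hausdorff_space (stalk_topology V x)) \<and>
    openin (total V) = arbitrary union_of (\<lambda>T. T \<in> tubes V)"

definition endo_module :: "('x, 'e, 'j) tvs_bundle \<Rightarrow> 'x \<Rightarrow> (complex, 'e \<Rightarrow> 'e) module"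
  where "endo_module V x =
    (let M = stalk V x in
      \<lparr>carrier = {T \<in> linear_maps M M. continuous_map (stalk_topology V x) (stalk_topology V x) T},
       mult = compose (carrier M),
       one = restrict id (carrier M),
       zero = (\<lambda>e\<in>carrier M. \<zero>\<^bsub>M\<^esub>),
       add = (\<lambda>S T. \<lambda>e\<in>carrier M. S e \<oplus>\<^bsub>M\<^esub> T e),
       smult = (\<lambda>c T. \<lambda>e\<in>carrier M. c \<odot>\<^bsub>M\<^esub> T e)\<rparr>)"

definition bounded_sets :: "('x, 'e, 'j) tvs_bundle \<Rightarrow> 'x \<Rightarrow> 'e set set"
  where "bounded_sets V x =
    {A. A \<subseteq> carrier (stalk V x) \<and> (\<forall>j\<in>sn_index V. bdd_above (sn V j ` A))}"

definition D_set :: "('x, 'e, 'j) tvs_bundle \<Rightarrow> ('x \<Rightarrow> 'e set) \<Rightarrow> ('x \<Rightarrow> 'e) set \<Rightarrow> ('x \<Rightarrow> 'e) set"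
  where "D_set V B \<E> = \<E> \<inter> (\<Pi>\<^sub>E x\<in>topspace (base_space V). B x)"

definition B_set :: "('x, 'e, 'j) tvs_bundle \<Rightarrow> ('x \<Rightarrow> 'e) set \<Rightarrow> ('x \<Rightarrow> 'e set) \<Rightarrow> 'x \<Rightarrow> 'e set"
  where "B_set V \<E> B x = (\<lambda>v. v x) ` D_set V B \<E>"

definition S_family ::
    "('x, 'e, 'j) tvs_bundle \<Rightarrow> ('x \<Rightarrow> 'e set) set \<Rightarrow> ('x \<Rightarrow> 'e) set \<Rightarrow> 'x \<Rightarrow> 'e set set"
  where "S_family V \<Theta> \<E> x = (\<lambda>B. B_set V \<E> B x) ` \<Theta>"

definition E_Theta :: "('x, 'e, 'j) tvs_bundle \<Rightarrow> ('x \<Rightarrow> 'e set) set \<Rightarrow> ('x \<Rightarrow> 'e) set \<Rightarrow> ('x \<Rightarrow> 'e) set"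
  where "E_Theta V \<Theta> \<E> = (\<Union>B\<in>\<Theta>. D_set V B \<E>)"

definition unif_conv_seminorms ::
    "('x, 'e, 'j) tvs_bundle \<Rightarrow> 'e set set \<Rightarrow> (('e \<Rightarrow> 'e) \<Rightarrow> real) set"
  where "unif_conv_seminorms V S =
    {(\<lambda>T. SUP e\<in>A. sn V j (T e)) | j A. j \<in> sn_index V \<and> A \<in> S}"

definition P_seminorm ::
    "('x, 'e, 'j) tvs_bundle \<Rightarrow> ('x \<Rightarrow> 'e) set \<Rightarrow> 'x \<Rightarrow> 'y \<times> 'j \<times> ('x \<Rightarrow> 'e set)
      \<Rightarrow> ('y \<Rightarrow> 'e \<Rightarrow> 'e) \<Rightarrow> real"
  where "P_seminorm V \<E> x = (\<lambda>(t, j, B) F. SUP v\<in>D_set V B \<E>. sn V j (F t (v x)))"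

text \<open>
  The stalks of the second bundle are spaces of maps \<open>F\<close> from \<open>Y\<close> to the endomorphisms of the
  stalk over \<open>x\<close>. Their disjoint union is represented by pairs \<open>(x, F)\<close>, with pointwise vector
  space operations. The supremum over the empty set of seminorms is 0.
\<close>

type_synonym ('x, 'e, 'j, 'y) op_bundle =
  "('x, 'x \<times> ('y \<Rightarrow> 'e \<Rightarrow> 'e), ('y \<times> 'j \<times> ('x \<Rightarrow> 'e set)) set) tvs_bundle"

definition theta_structure ::
    "('x, 'e, 'j) tvs_bundle \<Rightarrow> ('x, 'e, 'j, 'y) op_bundle \<Rightarrow> 'y topology
      \<Rightarrow> ('x \<Rightarrow> 'e set) set \<Rightarrow> ('x \<Rightarrow> 'e) set \<Rightarrow> (('y \<Rightarrow> complex) \<Rightarrow> complex) \<Rightarrow> bool"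
  where "theta_structure V Q Y \<Theta> \<E> \<mu> \<longleftrightarrow>
    omega_bundle V \<and>
    \<E> \<subseteq> cont_sections V \<and>
    \<Theta> \<subseteq> (\<Pi>\<^sub>E x\<in>topspace (base_space V). bounded_sets V x) \<and>
    (\<forall>B\<in>\<Theta>. D_set V B \<E> \<noteq> {}) \<and>
    (\<forall>x\<in>topspace (base_space V).
       stalk_topology V x closure_of linear_span (stalk V x) (\<Union>B\<in>\<Theta>. B_set V \<E> B x)
         = carrier (stalk V x)) \<and>
    omega_bundle Q \<and>
    base_space Q = base_space V \<and>
    (\<forall>h\<in>topspace (total Q). proj Q h = fst h) \<and>
    (\<forall>x\<in>topspace (base_space V).
       carrier (stalk Q x) \<subseteq>
         {x} \<times> L1_space Y \<mu> (endo_module V x) (unif_conv_seminorms V (S_family V \<Theta> \<E> x)) \<and>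
       (\<forall>F G. (x, F) \<in> carrier (stalk Q x) \<and> (x, G) \<in> carrier (stalk Q x) \<longrightarrow>
          (x, F) \<oplus>\<^bsub>stalk Q x\<^esub> (x, G) = (x, \<lambda>t\<in>topspace Y. F t \<oplus>\<^bsub>endo_module V x\<^esub> G t)) \<and>
       (\<forall>c F. (x, F) \<in> carrier (stalk Q x) \<longrightarrow>
          c \<odot>\<^bsub>stalk Q x\<^esub> (x, F) = (x, \<lambda>t\<in>topspace Y. c \<odot>\<^bsub>endo_module V x\<^esub> F t))) \<and>
    sn_index Q = {N. finite N \<and> N \<subseteq> topspace Y \<times> sn_index V \<times> \<Theta>} \<and>
    (\<forall>N\<in>sn_index Q. \<forall>(x, F)\<in>topspace (total Q).
       sn Q N (x, F) = Max (insert 0 ((\<lambda>i. P_seminorm V \<E> x i F) ` N)))"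

definition eval_at ::
    "('x, 'e, 'j) tvs_bundle \<Rightarrow> ('x \<Rightarrow> 'x \<times> ('y \<Rightarrow> 'e \<Rightarrow> 'e)) \<Rightarrow> 'y \<Rightarrow> 'x \<Rightarrow> 'e \<Rightarrow> 'e"
  where "eval_at V F t = (\<lambda>x\<in>topspace (base_space V). snd (F x) t)"

definition bullet ::
    "('x, 'e, 'j) tvs_bundle \<Rightarrow> ('x \<Rightarrow> 'e \<Rightarrow> 'e) \<Rightarrow> ('x \<Rightarrow> 'e) \<Rightarrow> 'x \<Rightarrow> 'e"
  where "bullet V T w = (\<lambda>x\<in>topspace (base_space V). T x (w x))"

definition invariant_theta_structure ::
    "('x, 'e, 'j) tvs_bundle \<Rightarrow> ('x, 'e, 'j, 'y) op_bundle \<Rightarrow> 'y topology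
      \<Rightarrow> ('x \<Rightarrow> 'e set) set \<Rightarrow> ('x \<Rightarrow> 'e) set \<Rightarrow> (('y \<Rightarrow> complex) \<Rightarrow> complex) \<Rightarrow> bool"
  where "invariant_theta_structure V Q Y \<Theta> \<E> \<mu> \<longleftrightarrow>
    theta_structure V Q Y \<Theta> \<E> \<mu> \<and>
    {F \<in> bounded_sections Q (topspace (base_space Q)).
       \<forall>t\<in>topspace Y. bullet V (eval_at V F t) ` E_Theta V \<Theta> \<E> \<subseteq> cont_sections V}
      = cont_sections Q"

definition diamond :: "('x, 'h, 'k) tvs_bundle \<Rightarrow> ('x \<Rightarrow> 'h) set \<Rightarrow> 'x \<Rightarrow> ('x \<Rightarrow> 'h) set"
  where "diamond Q A x = {H \<in> A. \<exists>F\<in>cont_sections Q. H x = F x}"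

definition peq ::
    "('x, 'e, 'j) tvs_bundle \<Rightarrow> 'y topology \<Rightarrow> ('x \<Rightarrow> 'x \<times> ('y \<Rightarrow> 'e \<Rightarrow> 'e)) set
      \<Rightarrow> ('x \<Rightarrow> 'x \<times> ('y \<Rightarrow> 'e \<Rightarrow> 'e)) set"
  where "peq V Y A =
    {F \<in> A. \<forall>t\<in>topspace Y. \<forall>j\<in>sn_index V. \<exists>a>0. \<exists>j1\<in>sn_index V.
       \<forall>z\<in>topspace (base_space V). \<forall>v\<in>carrier (stalk V z).
         sn V j (snd (F z) t v) \<le> a * sn V j1 v}"

end

theory Submission
  imports Defs
begin

text \<open>
  Let \<open>F\<close> be a global continuous section through \<open>H x\<close>. Continuity of \<open>H\<close> at \<open>x\<close> amounts to
  \<open>\<nu> (H z - F z) \<longlonglongrightarrow> 0\<close> as \<open>z\<close> tends to \<open>x\<close>, for every seminorm \<open>\<nu>\<close> of the bundle. When the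
  sets \<open>D(B, \<E>)\<close> are finite (here they are singletons), the seminorms of the operator bundle at
  \<open>H z - F z\<close> are maxima of finitely many \<open>\<nu>\<^sub>j ((H\<^sub>t \<bullet> v) z - (F\<^sub>t \<bullet> v) z)\<close>. Each of these tends to 0
  by the same criterion, since \<open>H\<^sub>t \<bullet> v\<close> is continuous at \<open>x\<close> and, by invariance, \<open>F\<^sub>t \<bullet> v\<close> is a
  global continuous section.
\<close>

lemma tendsto_Max:
  fixes f :: "'i \<Rightarrow> 'a \<Rightarrow> 'b::linorder_topology"
  assumes "finite I" and "I \<noteq> {}" and "\<And>i. i \<in> I \<Longrightarrow> (f i \<longlongrightarrow> l i) F"
  shows "((\<lambda>x. Max ((\<lambda>i. f i x) ` I)) \<longlongrightarrow> Max (l ` I)) F"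
  using assms by (induction I rule: finite_ne_induct) (simp_all add: tendsto_max)

lemma eventually_nhdsin_openin:
  assumes "openin S U" and "x \<in> U"
  shows "\<forall>\<^sub>F z in nhdsin S x. z \<in> U"
  using assms by (auto simp: eventually_nhdsin)

lemma topcontinuous_at_nhdsin:
  "topcontinuous_at S T f x \<longleftrightarrow>
    x \<in> topspace S \<and> f \<in> topspace S \<rightarrow> topspace T \<and>
    (\<forall>G. openin T G \<longrightarrow> f x \<in> G \<longrightarrow> (\<forall>\<^sub>F z in nhdsin S x. f z \<in> G))"
  by (auto simp: topcontinuous_at_def eventually_nhdsin)

lemma (in abelian_group) minus_add_minus_cancel:
  assumes "a \<in> carrier G" and "b \<in> carrier G" and "c \<in> carrier G"
  shows "(a \<ominus> b) \<oplus> (b \<ominus> c) = a \<ominus> c"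
  using assms by (simp add: minus_eq a_assoc r_neg1)

lemma (in abelian_group_hom) hom_minus:
  assumes "a \<in> carrier G" and "b \<in> carrier G"
  shows "h (a \<ominus>\<^bsub>G\<^esub> b) = h a \<ominus>\<^bsub>H\<^esub> h b"
  using assms by (simp add: G.minus_eq H.minus_eq)

lemma seminorm_on_minus_self:
  assumes "module complex_field M" and "seminorm_on M p" and "a \<in> carrier M"
  shows "p (a \<ominus>\<^bsub>M\<^esub> a) = 0"
proof -
  interpret module complex_field M by fact
  have "a \<ominus>\<^bsub>M\<^esub> a = 0 \<odot>\<^bsub>M\<^esub> a"
    using smult_l_null[OF assms(3)] assms(3)
    by (simp add: M.minus_eq M.r_neg ring_of_type_algebra_def)
  then show ?thesis
    using assms(2,3) by (simp add: seminorm_on_def)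
qed

lemma seminorm_on_minus_triangle:
  assumes "abelian_group M" and "seminorm_on M p"
    and "a \<in> carrier M" and "b \<in> carrier M" and "c \<in> carrier M"
  shows "p (a \<ominus>\<^bsub>M\<^esub> c) \<le> p (a \<ominus>\<^bsub>M\<^esub> b) + p (b \<ominus>\<^bsub>M\<^esub> c)"
proof -
  interpret abelian_group M by fact
  have "p ((a \<ominus>\<^bsub>M\<^esub> b) \<oplus>\<^bsub>M\<^esub> (b \<ominus>\<^bsub>M\<^esub> c)) \<le> p (a \<ominus>\<^bsub>M\<^esub> b) + p (b \<ominus>\<^bsub>M\<^esub> c)"
    using assms(2-5) by (simp add: seminorm_on_def)
  then show ?thesis
    using assms(3-5) by (simp add: minus_add_minus_cancel)
qed


section \<open>Continuity of sections in terms of the seminorms\<close>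

lemma
  assumes "omega_bundle V" and "x \<in> topspace (base_space V)"
  shows omega_bundle_module: "module complex_field (stalk V x)"
    and omega_bundle_carrier: "carrier (stalk V x) = {e \<in> topspace (total V). proj V e = x}"
    and omega_bundle_seminorm: "j \<in> sn_index V \<Longrightarrow> seminorm_on (stalk V x) (sn V j)"
  using assms by (auto simp: omega_bundle_def)

lemma omega_bundle_abelian_group:
  assumes "omega_bundle V" and "x \<in> topspace (base_space V)"
  shows "abelian_group (stalk V x)"
  using omega_bundle_module[OF assms] by (rule module.axioms)

lemma openin_total_iff_tubes:
  assumes "omega_bundle V"
  shows "openin (total V) W \<longleftrightarrow> (\<forall>e\<in>W. \<exists>T\<in>tubes V. e \<in> T \<and> T \<subseteq> W)"
proof -
  have "openin (total V) = arbitrary union_of (\<lambda>T. T \<in> tubes V)"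
    using assms by (simp add: omega_bundle_def)
  then show ?thesis
    by (auto simp: arbitrary_union_of_alt)
qed

lemma openin_tube:
  assumes "omega_bundle V" and "openin (base_space V) U" and "\<sigma> \<in> cont_sections_on V U"
    and "\<epsilon> > 0" and "j \<in> sn_index V"
  shows "openin (total V) (tube V U \<sigma> \<epsilon> j)"
proof -
  have "tube V U \<sigma> \<epsilon> j \<in> tubes V"
    using assms(2-5) by (auto simp: tubes_def)
  then show ?thesis
    by (auto simp: openin_total_iff_tubes[OF assms(1)])
qed

lemma bounded_sections_carrier:
  "\<sigma> \<in> bounded_sections V U \<Longrightarrow> z \<in> U \<Longrightarrow> \<sigma> z \<in> carrier (stalk V z)"
  by (auto simp: bounded_sections_def)

lemma cont_sections_on_subset_bounded_sections: "cont_sections_on V U \<subseteq> bounded_sections V U"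
  by (auto simp: cont_sections_on_def)

lemma cont_sections_on_at_subset_bounded_sections:
  "cont_sections_on_at V U x \<subseteq> bounded_sections V U"
  by (auto simp: cont_sections_on_at_def)

lemmas cont_sections_on_carrier =
  bounded_sections_carrier[OF subsetD[OF cont_sections_on_subset_bounded_sections]]

lemmas cont_sections_on_at_carrier =
  bounded_sections_carrier[OF subsetD[OF cont_sections_on_at_subset_bounded_sections]]

lemma cont_sections_on_subset_extensional: "cont_sections_on V U \<subseteq> extensional U"
  by (auto simp: cont_sections_on_def bounded_sections_def PiE_def)

lemma cont_sections_subset_cont_sections_at:
  assumes "x \<in> topspace (base_space V)"
  shows "cont_sections V \<subseteq> cont_sections_at V x"
  using assms
  by (auto simp: cont_sections_on_def cont_sections_on_at_def continuous_map_eq_topcontinuous_at)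

definition fibre_dist :: "('x, 'e, 'j) tvs_bundle \<Rightarrow> 'j \<Rightarrow> 'x \<Rightarrow> 'e \<Rightarrow> 'e \<Rightarrow> real"
  where "fibre_dist V j z a b = sn V j (a \<ominus>\<^bsub>stalk V z\<^esub> b)"

context
  fixes V :: "('x, 'e, 'j) tvs_bundle" and j :: 'j and z :: 'x
  assumes V: "omega_bundle V" and j: "j \<in> sn_index V" and z: "z \<in> topspace (base_space V)"
begin

lemma fibre_dist_nonneg:
  assumes "a \<in> carrier (stalk V z)" and "b \<in> carrier (stalk V z)"
  shows "0 \<le> fibre_dist V j z a b"
  using assms omega_bundle_seminorm[OF V z j]
    abelian_group.minus_closed[OF omega_bundle_abelian_group[OF V z]]
  by (simp add: fibre_dist_def seminorm_on_def)

lemma fibre_dist_self: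
  "a \<in> carrier (stalk V z) \<Longrightarrow> fibre_dist V j z a a = 0"
  unfolding fibre_dist_def
  by (rule seminorm_on_minus_self[OF omega_bundle_module[OF V z] omega_bundle_seminorm[OF V z j]])

lemma fibre_dist_triangle:
  assumes "a \<in> carrier (stalk V z)" and "b \<in> carrier (stalk V z)" and "c \<in> carrier (stalk V z)"
  shows "fibre_dist V j z a c \<le> fibre_dist V j z a b + fibre_dist V j z b c"
  unfolding fibre_dist_def
  by (rule seminorm_on_minus_triangle[OF omega_bundle_abelian_group[OF V z]
        omega_bundle_seminorm[OF V z j] assms])

end

lemma mem_tube_iff_fibre_dist:
  assumes "omega_bundle V" and "z \<in> topspace (base_space V)" and "e \<in> carrier (stalk V z)"
  shows "e \<in> tube V U \<sigma> \<epsilon> j \<longleftrightarrow> z \<in> U \<and> fibre_dist V j z e (\<sigma> z) < \<epsilon>"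
  using assms by (auto simp: tube_def fibre_dist_def omega_bundle_carrier)

lemma eventually_fibre_dist_less:
  assumes V: "omega_bundle V" and H: "H \<in> cont_sections_at V x"
    and U: "openin (base_space V) U" "x \<in> U" and \<sigma>: "\<sigma> \<in> cont_sections_on V U"
    and j: "j \<in> sn_index V" and less: "fibre_dist V j x (H x) (\<sigma> x) < \<epsilon>"
  shows "\<forall>\<^sub>F z in nhdsin (base_space V) x. fibre_dist V j z (H z) (\<sigma> z) < \<epsilon>"
proof -
  note carrier = cont_sections_on_at_carrier[OF H]
  have x: "x \<in> topspace (base_space V)"
    using U openin_subset by blast
  have "\<epsilon> > 0"
    using fibre_dist_nonneg[OF V j x carrier[OF x] cont_sections_on_carrier[OF \<sigma> U(2)]] less
    by simp
  then have "openin (total V) (tube V U \<sigma> \<epsilon> j)"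
    by (rule openin_tube[OF V U(1) \<sigma> _ j])
  moreover have "H x \<in> tube V U \<sigma> \<epsilon> j"
    using mem_tube_iff_fibre_dist[OF V x carrier[OF x]] U(2) less by simp
  ultimately have "\<forall>\<^sub>F z in nhdsin (base_space V) x. H z \<in> tube V U \<sigma> \<epsilon> j"
    using H by (simp add: cont_sections_on_at_def topcontinuous_at_nhdsin)
  with eventually_nhdsin_openin[OF openin_topspace x] show ?thesis
    by eventually_elim (simp add: mem_tube_iff_fibre_dist[OF V _ carrier])
qed

lemma cont_sections_atI_fibre_dist:
  assumes V: "omega_bundle V" and x: "x \<in> topspace (base_space V)"
    and H: "H \<in> bounded_sections V (topspace (base_space V))"
    and near: "\<And>U \<sigma> j \<epsilon>. \<lbrakk>openin (base_space V) U; x \<in> U; \<sigma> \<in> cont_sections_on V U;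
        j \<in> sn_index V; fibre_dist V j x (H x) (\<sigma> x) < \<epsilon>\<rbrakk>
      \<Longrightarrow> \<forall>\<^sub>F z in nhdsin (base_space V) x. fibre_dist V j z (H z) (\<sigma> z) < \<epsilon>"
  shows "H \<in> cont_sections_at V x"
proof -
  note carrier = bounded_sections_carrier[OF H]
  have "\<forall>\<^sub>F z in nhdsin (base_space V) x. H z \<in> G" if "openin (total V) G" and "H x \<in> G" for G
  proof -
    obtain T where "T \<in> tubes V" and "H x \<in> T" and "T \<subseteq> G"
      using \<open>openin (total V) G\<close> \<open>H x \<in> G\<close> unfolding openin_total_iff_tubes[OF V] by blast
    then obtain U \<sigma> \<epsilon> j where U: "openin (base_space V) U" and \<sigma>: "\<sigma> \<in> cont_sections_on V U"
      and j: "j \<in> sn_index V" and Hx: "H x \<in> tube V U \<sigma> \<epsilon> j" and sub: "tube V U \<sigma> \<epsilon> j \<subseteq> G"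
      by (auto simp: tubes_def)
    have xU: "x \<in> U" and less: "fibre_dist V j x (H x) (\<sigma> x) < \<epsilon>"
      using Hx by (simp_all add: mem_tube_iff_fibre_dist[OF V x carrier[OF x]])
    show ?thesis
      using near[OF U xU \<sigma> j less] eventually_nhdsin_openin[OF U xU]
        eventually_nhdsin_openin[OF openin_topspace x]
    proof eventually_elim
      case (elim z)
      then show ?case
        using mem_tube_iff_fibre_dist[OF V elim(3) carrier[OF elim(3)]] sub by blast
    qed
  qed
  moreover have "H \<in> topspace (base_space V) \<rightarrow> topspace (total V)"
    using carrier by (auto simp: omega_bundle_carrier[OF V])
  ultimately show ?thesis
    using H x by (simp add: cont_sections_on_at_def topcontinuous_at_nhdsin)
qed

lemma tendsto_fibre_dist_zero:
  assumes V: "omega_bundle V" and H: "H \<in> cont_sections_at V x" and F: "F \<in> cont_sections V"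
    and x: "x \<in> topspace (base_space V)" and agree: "H x = F x" and j: "j \<in> sn_index V"
  shows "((\<lambda>z. fibre_dist V j z (H z) (F z)) \<longlongrightarrow> 0) (nhdsin (base_space V) x)"
proof (rule order_tendstoI)
  note carrier = cont_sections_on_at_carrier[OF H]
  show "\<forall>\<^sub>F z in nhdsin (base_space V) x. fibre_dist V j z (H z) (F z) < \<epsilon>" if "0 < \<epsilon>" for \<epsilon>
    using eventually_fibre_dist_less[OF V H openin_topspace x F j] that
      fibre_dist_self[OF V j x carrier[OF x]] agree by simp
  show "\<forall>\<^sub>F z in nhdsin (base_space V) x. \<epsilon> < fibre_dist V j z (H z) (F z)" if "\<epsilon> < 0" for \<epsilon>
    using eventually_nhdsin_openin[OF openin_topspace x]
  proof eventually_elim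
    case (elim z)
    then show ?case
      using fibre_dist_nonneg[OF V j elim carrier cont_sections_on_carrier[OF F]] that by force
  qed
qed

lemma cont_sections_atI_tendsto:
  assumes V: "omega_bundle V" and x: "x \<in> topspace (base_space V)"
    and H: "H \<in> bounded_sections V (topspace (base_space V))" and F: "F \<in> cont_sections_at V x"
    and agree: "H x = F x"
    and lim: "\<And>j. j \<in> sn_index V
      \<Longrightarrow> ((\<lambda>z. fibre_dist V j z (H z) (F z)) \<longlongrightarrow> 0) (nhdsin (base_space V) x)"
  shows "H \<in> cont_sections_at V x"
proof (rule cont_sections_atI_fibre_dist[OF V x H])
  fix U \<sigma> j and \<epsilon> :: real
  assume U: "openin (base_space V) U" "x \<in> U" and \<sigma>: "\<sigma> \<in> cont_sections_on V U"
    and j: "j \<in> sn_index V" and "fibre_dist V j x (H x) (\<sigma> x) < \<epsilon>"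
  then have "fibre_dist V j x (F x) (\<sigma> x) < \<epsilon>"
    by (simp add: agree)
  then obtain \<delta> where \<delta>: "fibre_dist V j x (F x) (\<sigma> x) < \<delta>" "\<delta> < \<epsilon>"
    using dense by blast
  have "\<forall>\<^sub>F z in nhdsin (base_space V) x. fibre_dist V j z (F z) (\<sigma> z) < \<delta>"
    by (rule eventually_fibre_dist_less[OF V F U \<sigma> j \<delta>(1)])
  moreover have "\<forall>\<^sub>F z in nhdsin (base_space V) x. fibre_dist V j z (H z) (F z) < \<epsilon> - \<delta>"
    using order_tendstoD(2)[OF lim[OF j]] \<delta>(2) by simp
  moreover note eventually_nhdsin_openin[OF U]
  ultimately show "\<forall>\<^sub>F z in nhdsin (base_space V) x. fibre_dist V j z (H z) (\<sigma> z) < \<epsilon>"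
  proof eventually_elim
    case (elim z)
    have z: "z \<in> topspace (base_space V)"
      using U(1) elim(3) openin_subset by blast
    have "fibre_dist V j z (H z) (\<sigma> z) \<le> fibre_dist V j z (H z) (F z) + fibre_dist V j z (F z) (\<sigma> z)"
      by (rule fibre_dist_triangle[OF V j z bounded_sections_carrier[OF H z]
            cont_sections_on_at_carrier[OF F z] cont_sections_on_carrier[OF \<sigma> elim(3)]])
    then show ?case
      using elim(1,2) by simp
  qed
qed


section \<open>The operator bundle\<close>

lemma
  assumes "theta_structure V Q Y \<Theta> \<E> \<mu>"
  shows theta_structure_omega_bundle: "omega_bundle V"
    and theta_structure_cont_sections: "\<E> \<subseteq> cont_sections V"
    and theta_structure_D_set_nonempty: "B \<in> \<Theta> \<Longrightarrow> D_set V B \<E> \<noteq> {}"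
    and theta_structure_operator_bundle: "omega_bundle Q"
    and theta_structure_base_space: "base_space Q = base_space V"
    and theta_structure_sn_index:
      "sn_index Q = {N. finite N \<and> N \<subseteq> topspace Y \<times> sn_index V \<times> \<Theta>}"
  using assms by (auto simp: theta_structure_def)

lemma theta_structure_sn:
  assumes "theta_structure V Q Y \<Theta> \<E> \<mu>" and "N \<in> sn_index Q" and "h \<in> topspace (total Q)"
  shows "sn Q N h = Max (insert 0 ((\<lambda>i. P_seminorm V \<E> (fst h) i (snd h)) ` N))"
  using assms unfolding theta_structure_def by (cases h) auto

lemma
  assumes "theta_structure V Q Y \<Theta> \<E> \<mu>" and "z \<in> topspace (base_space V)"
    and "h \<in> carrier (stalk Q z)"
  shows theta_structure_fst: "fst h = z"
    and theta_structure_apply_carrier: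
      "t \<in> topspace Y \<Longrightarrow> e \<in> carrier (stalk V z) \<Longrightarrow> snd h t e \<in> carrier (stalk V z)"
proof -
  have h: "h \<in> {z} \<times> L1_space Y \<mu> (endo_module V z) (unif_conv_seminorms V (S_family V \<Theta> \<E> z))"
    using assms by (auto simp: theta_structure_def)
  then show "fst h = z"
    by auto
  assume "t \<in> topspace Y" and "e \<in> carrier (stalk V z)"
  moreover from this have "snd h t \<in> carrier (endo_module V z)"
    using h by (auto simp: L1_space_def)
  ultimately show "snd h t e \<in> carrier (stalk V z)"
    by (auto simp: endo_module_def Let_def linear_maps_def)
qed

lemma theta_structure_apply_hom:
  assumes theta: "theta_structure V Q Y \<Theta> \<E> \<mu>" and z: "z \<in> topspace (base_space V)"
    and t: "t \<in> topspace Y" and e: "e \<in> carrier (stalk V z)"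
  shows "abelian_group_hom (stalk Q z) (stalk V z) (\<lambda>h. snd h t e)"
proof (rule abelian_group_homI)
  show group_V: "abelian_group (stalk V z)"
    by (rule omega_bundle_abelian_group[OF theta_structure_omega_bundle[OF theta] z])
  show group_Q: "abelian_group (stalk Q z)"
    using omega_bundle_abelian_group[OF theta_structure_operator_bundle[OF theta]] z
      theta_structure_base_space[OF theta] by simp
  have "snd (f \<oplus>\<^bsub>stalk Q z\<^esub> g) t e = snd f t e \<oplus>\<^bsub>stalk V z\<^esub> snd g t e"
    if f: "f \<in> carrier (stalk Q z)" and g: "g \<in> carrier (stalk Q z)" for f g
  proof -
    have "f \<oplus>\<^bsub>stalk Q z\<^esub> g = (z, \<lambda>t\<in>topspace Y. snd f t \<oplus>\<^bsub>endo_module V z\<^esub> snd g t)"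
      using theta_structure_fst[OF theta z f] theta_structure_fst[OF theta z g] f g theta z
      by (cases f; cases g) (simp add: theta_structure_def)
    then show ?thesis
      using t e by (simp add: endo_module_def Let_def)
  qed
  then have "(\<lambda>h. snd h t e) \<in> hom (add_monoid (stalk Q z)) (add_monoid (stalk V z))"
    using theta_structure_apply_carrier[OF theta z _ t e] by (simp add: hom_def)
  then show "group_hom (add_monoid (stalk Q z)) (add_monoid (stalk V z)) (\<lambda>h. snd h t e)"
    by (intro group_hom.intro group_hom_axioms.intro abelian_group.a_group group_Q group_V)
qed

lemma P_seminorm_minus:
  assumes theta: "theta_structure V Q Y \<Theta> \<E> \<mu>" and z: "z \<in> topspace (base_space V)"
    and f: "f \<in> carrier (stalk Q z)" and g: "g \<in> carrier (stalk Q z)" and t: "t \<in> topspace Y"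
  shows "P_seminorm V \<E> z (t, j, B) (snd (f \<ominus>\<^bsub>stalk Q z\<^esub> g)) =
    (SUP v\<in>D_set V B \<E>. fibre_dist V j z (snd f t (v z)) (snd g t (v z)))"
proof -
  have "snd (f \<ominus>\<^bsub>stalk Q z\<^esub> g) t (v z) = snd f t (v z) \<ominus>\<^bsub>stalk V z\<^esub> snd g t (v z)"
    if "v \<in> D_set V B \<E>" for v
  proof -
    have "v \<in> cont_sections V"
      using that theta_structure_cont_sections[OF theta] by (auto simp: D_set_def)
    then have "v z \<in> carrier (stalk V z)"
      using z by (rule cont_sections_on_carrier)
    from abelian_group_hom.hom_minus[OF theta_structure_apply_hom[OF theta z t this] f g]
    show ?thesis .
  qed
  then show ?thesis
    by (simp add: P_seminorm_def fibre_dist_def)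
qed

lemma fibre_dist_operator_bundle_eq_Max:
  assumes theta: "theta_structure V Q Y \<Theta> \<E> \<mu>" and N: "N \<in> sn_index Q"
    and z: "z \<in> topspace (base_space V)"
    and f: "f \<in> carrier (stalk Q z)" and g: "g \<in> carrier (stalk Q z)"
  shows "fibre_dist Q N z f g =
    Max (insert 0 ((\<lambda>i. P_seminorm V \<E> z i (snd (f \<ominus>\<^bsub>stalk Q z\<^esub> g))) ` N))"
proof -
  note Q = theta_structure_operator_bundle[OF theta]
  have zQ: "z \<in> topspace (base_space Q)"
    using z by (simp add: theta_structure_base_space[OF theta])
  have diff_carrier: "f \<ominus>\<^bsub>stalk Q z\<^esub> g \<in> carrier (stalk Q z)"
    by (rule abelian_group.minus_closed[OF omega_bundle_abelian_group[OF Q zQ] f g])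
  then have "f \<ominus>\<^bsub>stalk Q z\<^esub> g \<in> topspace (total Q)"
    by (simp add: omega_bundle_carrier[OF Q zQ])
  from theta_structure_sn[OF theta N this] show ?thesis
    by (simp add: fibre_dist_def theta_structure_fst[OF theta z diff_carrier])
qed

lemma tendsto_P_seminorm_minus_zero:
  assumes theta: "theta_structure V Q Y \<Theta> \<E> \<mu>" and x: "x \<in> topspace (base_space V)"
    and H: "H \<in> bounded_sections Q (topspace (base_space Q))"
    and F: "F \<in> bounded_sections Q (topspace (base_space Q))"
    and agree: "H x = F x" and t: "t \<in> topspace Y" and j: "j \<in> sn_index V"
    and B: "B \<in> \<Theta>" and finite_D: "finite (D_set V B \<E>)"
    and H_cont: "\<And>v. v \<in> D_set V B \<E> \<Longrightarrow> bullet V (eval_at V H t) v \<in> cont_sections_at V x"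
    and F_cont: "\<And>v. v \<in> D_set V B \<E> \<Longrightarrow> bullet V (eval_at V F t) v \<in> cont_sections V"
  shows "((\<lambda>z. P_seminorm V \<E> z (t, j, B) (snd (H z \<ominus>\<^bsub>stalk Q z\<^esub> F z))) \<longlongrightarrow> 0)
    (nhdsin (base_space V) x)"
proof -
  let ?d = "\<lambda>v z. fibre_dist V j z (bullet V (eval_at V H t) v z) (bullet V (eval_at V F t) v z)"
  note D_nonempty = theta_structure_D_set_nonempty[OF theta B]
  have "(?d v \<longlongrightarrow> 0) (nhdsin (base_space V) x)" if "v \<in> D_set V B \<E>" for v
  proof (rule tendsto_fibre_dist_zero[OF theta_structure_omega_bundle[OF theta]
        H_cont[OF that] F_cont[OF that] x _ j])
    show "bullet V (eval_at V H t) v x = bullet V (eval_at V F t) v x"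
      using x agree by (simp add: bullet_def eval_at_def)
  qed
  from tendsto_Max[OF finite_D D_nonempty this]
  have "((\<lambda>z. Max ((\<lambda>v. ?d v z) ` D_set V B \<E>)) \<longlongrightarrow> 0) (nhdsin (base_space V) x)"
    using D_nonempty by (simp add: image_constant_conv)
  moreover have "\<forall>\<^sub>F z in nhdsin (base_space V) x.
      P_seminorm V \<E> z (t, j, B) (snd (H z \<ominus>\<^bsub>stalk Q z\<^esub> F z)) =
      Max ((\<lambda>v. ?d v z) ` D_set V B \<E>)"
    using eventually_nhdsin_openin[OF openin_topspace x]
  proof eventually_elim
    case (elim z)
    then have zQ: "z \<in> topspace (base_space Q)"
      by (simp add: theta_structure_base_space[OF theta])
    show ?case
      using P_seminorm_minus[OF theta elim bounded_sections_carrier[OF H zQ]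
          bounded_sections_carrier[OF F zQ] t] finite_D D_nonempty
      by (simp add: cSup_eq_Max bullet_def eval_at_def elim)
  qed
  ultimately show ?thesis
    by (simp add: tendsto_cong)
qed

lemma tendsto_fibre_dist_operator_bundle_zero:
  assumes theta: "theta_structure V Q Y \<Theta> \<E> \<mu>" and N: "N \<in> sn_index Q"
    and x: "x \<in> topspace (base_space V)"
    and H: "H \<in> bounded_sections Q (topspace (base_space Q))"
    and F: "F \<in> bounded_sections Q (topspace (base_space Q))"
    and lim: "\<And>i. i \<in> N \<Longrightarrow>
      ((\<lambda>z. P_seminorm V \<E> z i (snd (H z \<ominus>\<^bsub>stalk Q z\<^esub> F z))) \<longlongrightarrow> 0) (nhdsin (base_space V) x)"
  shows "((\<lambda>z. fibre_dist Q N z (H z) (F z)) \<longlongrightarrow> 0) (nhdsin (base_space V) x)"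
proof -
  let ?P = "\<lambda>i z. P_seminorm V \<E> z i (snd (H z \<ominus>\<^bsub>stalk Q z\<^esub> F z))"
  have finite_N: "finite N"
    using N by (simp add: theta_structure_sn_index[OF theta])
  have "((\<lambda>z. Max (insert 0 ((\<lambda>i. ?P i z) ` N))) \<longlongrightarrow> 0) (nhdsin (base_space V) x)"
  proof (cases "N = {}")
    case False
    have "((\<lambda>z. max 0 (Max ((\<lambda>i. ?P i z) ` N))) \<longlongrightarrow> max 0 (Max ((\<lambda>_. 0) ` N)))
        (nhdsin (base_space V) x)"
      by (intro tendsto_max tendsto_const tendsto_Max[OF finite_N False] lim)
    then show ?thesis
      using finite_N False by (simp add: image_constant_conv)
  qed simp
  moreover have "\<forall>\<^sub>F z in nhdsin (base_space V) x.
      fibre_dist Q N z (H z) (F z) = Max (insert 0 ((\<lambda>i. ?P i z) ` N))"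
    using eventually_nhdsin_openin[OF openin_topspace x]
    by eventually_elim
      (simp add: fibre_dist_operator_bundle_eq_Max[OF theta N] theta_structure_base_space[OF theta]
        bounded_sections_carrier[OF H] bounded_sections_carrier[OF F])
  ultimately show ?thesis
    by (simp add: tendsto_cong)
qed

lemma theta_structure_cont_sections_atI:
  assumes theta: "theta_structure V Q Y \<Theta> \<E> \<mu>"
    and finite_D: "\<And>B. B \<in> \<Theta> \<Longrightarrow> finite (D_set V B \<E>)"
    and x: "x \<in> topspace (base_space V)"
    and H: "H \<in> bounded_sections Q (topspace (base_space Q))" and F: "F \<in> cont_sections Q"
    and agree: "H x = F x"
    and H_cont: "\<And>t v. \<lbrakk>t \<in> topspace Y; v \<in> E_Theta V \<Theta> \<E>\<rbrakk>
      \<Longrightarrow> bullet V (eval_at V H t) v \<in> cont_sections_at V x"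
    and F_cont: "\<And>t v. \<lbrakk>t \<in> topspace Y; v \<in> E_Theta V \<Theta> \<E>\<rbrakk>
      \<Longrightarrow> bullet V (eval_at V F t) v \<in> cont_sections V"
  shows "H \<in> cont_sections_at Q x"
proof -
  note base = theta_structure_base_space[OF theta]
  have xQ: "x \<in> topspace (base_space Q)"
    using x base by simp
  have F_at: "F \<in> cont_sections_at Q x"
    using F cont_sections_subset_cont_sections_at[OF xQ] by blast
  have F_bounded: "F \<in> bounded_sections Q (topspace (base_space Q))"
    using F cont_sections_on_subset_bounded_sections by blast
  show ?thesis
  proof (rule cont_sections_atI_tendsto[OF theta_structure_operator_bundle[OF theta] xQ H F_at agree])
    fix N assume N: "N \<in> sn_index Q"
    then have sub: "N \<subseteq> topspace Y \<times> sn_index V \<times> \<Theta>"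
      by (auto simp: theta_structure_sn_index[OF theta])
    have "((\<lambda>z. P_seminorm V \<E> z i (snd (H z \<ominus>\<^bsub>stalk Q z\<^esub> F z))) \<longlongrightarrow> 0)
      (nhdsin (base_space V) x)" if i_mem: "i \<in> N" for i
    proof -
      obtain t j B where i: "i = (t, j, B)" and t: "t \<in> topspace Y" and j: "j \<in> sn_index V"
        and B: "B \<in> \<Theta>"
        using subsetD[OF sub i_mem] by blast
      have "v \<in> E_Theta V \<Theta> \<E>" if "v \<in> D_set V B \<E>" for v
        using that B by (auto simp: E_Theta_def)
      then show ?thesis
        unfolding i
        by (intro tendsto_P_seminorm_minus_zero[OF theta x H F_bounded agree t j B finite_D[OF B]]
            H_cont F_cont t)
    qed
    then show "((\<lambda>z. fibre_dist Q N z (H z) (F z)) \<longlongrightarrow> 0) (nhdsin (base_space Q) x)"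
      unfolding base
      by (rule tendsto_fibre_dist_operator_bundle_zero[OF theta N x H F_bounded])
  qed
qed

lemma invariant_theta_structure_diamond:
  assumes inv: "invariant_theta_structure V Q Y \<Theta> \<E> \<mu>"
    and finite_D: "\<And>B. B \<in> \<Theta> \<Longrightarrow> finite (D_set V B \<E>)"
    and x: "x \<in> topspace (base_space V)"
    and H: "H \<in> diamond Q (bounded_sections Q (topspace (base_space Q))) x"
    and H_cont: "\<forall>t\<in>topspace Y. bullet V (eval_at V H t) ` E_Theta V \<Theta> \<E> \<subseteq> cont_sections_at V x"
  shows "H \<in> diamond Q (cont_sections_at Q x) x"
proof -
  obtain F where F: "F \<in> cont_sections Q" and agree: "H x = F x"
    and H_bounded: "H \<in> bounded_sections Q (topspace (base_space Q))"
    using H by (auto simp: diamond_def)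
  have theta: "theta_structure V Q Y \<Theta> \<E> \<mu>"
    using inv by (simp add: invariant_theta_structure_def)
  have "\<forall>t\<in>topspace Y. bullet V (eval_at V F t) ` E_Theta V \<Theta> \<E> \<subseteq> cont_sections V"
    using F inv unfolding invariant_theta_structure_def by blast
  then have "H \<in> cont_sections_at Q x"
    using H_cont by (intro theta_structure_cont_sections_atI[OF theta finite_D x H_bounded F agree])
      blast+
  then show ?thesis
    using F agree by (auto simp: diamond_def)
qed

lemma D_set_singleton:
  assumes "\<E> \<subseteq> extensional (topspace (base_space V))" and "w \<in> \<E>"
  shows "D_set V (\<lambda>x\<in>topspace (base_space V). {w x}) \<E> = {w}"
proof -
  let ?X = "topspace (base_space V)"
  have "(\<Pi>\<^sub>E x\<in>?X. (\<lambda>x\<in>?X. {w x}) x) = (\<Pi>\<^sub>E x\<in>?X. {w x})"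
    by (rule PiE_cong) simp
  also have "\<dots> = {w}"
    using assms by (intro PiE_singleton) blast
  finally show ?thesis
    using assms(2) by (auto simp: D_set_def)
qed

theorem lemma3p3p15:
  fixes V :: "('x, 'e, 'j) tvs_bundle"
    and Q :: "('x, 'e, 'j, 'y) op_bundle"
    and Y :: "'y topology"
    and \<mu> :: "('y \<Rightarrow> complex) \<Rightarrow> complex"
    and \<E> :: "('x \<Rightarrow> 'e) set"
    and \<Theta> :: "('x \<Rightarrow> 'e set) set"
  assumes "locally_compact_space Y" and "Hausdorff_space Y"
    and "radon_measure Y \<mu>"
    and "\<Theta> = {(\<lambda>x\<in>topspace (base_space V). {w x}) | w. w \<in> \<E>}"
    and "invariant_theta_structure V Q Y \<Theta> \<E> \<mu>"
  shows "\<forall>x\<in>topspace (base_space V).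
    {H \<in> peq V Y (diamond Q (bounded_sections Q (topspace (base_space Q))) x).
       \<forall>t\<in>topspace Y. bullet V (eval_at V H t) ` E_Theta V \<Theta> \<E> \<subseteq> cont_sections_at V x}
      \<subseteq> diamond Q (cont_sections_at Q x) x"
proof -
  have "theta_structure V Q Y \<Theta> \<E> \<mu>"
    using assms(5) by (simp add: invariant_theta_structure_def)
  then have "\<E> \<subseteq> extensional (topspace (base_space V))"
    by (rule subset_trans[OF theta_structure_cont_sections cont_sections_on_subset_extensional])
  then have "finite (D_set V B \<E>)" if "B \<in> \<Theta>" for B
    using that by (auto simp: assms(4) D_set_singleton)
  then show ?thesis
    using invariant_theta_structure_diamond[OF assms(5)] by (auto simp: peq_def)
qed

end
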